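(* Let $X$ and $Y$ be nontrivial real Banach spaces. The following conditions are equivalent: (1) $X$ is strictly convex and the pair $(X,Y)$ has Property $1$ for compact operators; (2) $X^*$ is Fréchet smooth.
   Context: All Banach spaces are real and different from $\{0\}$. $\mathbf{S}_X$ denotes the unit sphere of $X$, $L(X,Y)$ the space of bounded linear operators $X\to Y$ with the operator norm, and $\mathbf{S}_{L(X,Y)}$ the set of operators of norm $1$. The pair $(X,Y)$ has Property $1$ for compact operators if for every compact operator $T\in \mathbf{S}_{L(X,Y)}$ and every $\varepsilon>0$ there is $\eta(\varepsilon,T)>0$ such that whenever $x_0\in \mathbf{S}_X$ satisfies $\|T(x_0)\|>1-\eta(\varepsilon,T)$, there is $x_1\in \mathbf{S}_X$ such that $\|T(x_1)\|=1$ and $\|x_1-x_0\|<\varepsilon$. A Banach space is Fréchet smooth if its norm is Fréchet differentiable at every point other than the origin. Here $X^*$ carries the dual norm. *)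

theory Defs
  imports "HOL-Analysis.Analysis"
begin

text \<open>
  A Banach space is represented by a type of class \<open>banach\<close>; a property of a space becomes a
  predicate on \<open>itself\<close> types. The space of bounded operators with the operator norm is the
  library type \<open>'a \<Rightarrow>\<^sub>L 'b\<close>, so the dual of \<open>'a\<close> with the dual norm is \<open>'a \<Rightarrow>\<^sub>L real\<close>.
  The class \<open>banach\<close> admits the zero space.
\<close>

definition strictly_convex_space :: "'a::real_normed_vector itself \<Rightarrow> bool" where
  "strictly_convex_space _ \<longleftrightarrow>
     (\<forall>x\<in>sphere (0::'a) 1. \<forall>y\<in>sphere 0 1. x \<noteq> y \<longrightarrow> norm (x + y) < 2)"

definition compact_operator :: "('a::real_normed_vector \<Rightarrow>\<^sub>L 'b::real_normed_vector) \<Rightarrow> bool" where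
  "compact_operator T \<longleftrightarrow> compact (closure (blinfun_apply T ` cball 0 1))"

definition property_1_compact ::
  "'a::real_normed_vector itself \<Rightarrow> 'b::real_normed_vector itself \<Rightarrow> bool" where
  "property_1_compact _ _ \<longleftrightarrow>
     (\<forall>T\<in>sphere (0 :: 'a \<Rightarrow>\<^sub>L 'b) 1. compact_operator T \<longrightarrow>
        (\<forall>\<epsilon>>0. \<exists>\<eta>>0. \<forall>x0\<in>sphere 0 1. norm (T x0) > 1 - \<eta> \<longrightarrow>
           (\<exists>x1\<in>sphere 0 1. norm (T x1) = 1 \<and> norm (x1 - x0) < \<epsilon>)))"

text \<open>
  The library's \<open>differentiable\<close> is Frechet differentiability: its derivatives are bounded
  linear and the remainder is \<open>o(norm h)\<close>.
\<close>

definition frechet_smooth :: "'a::real_normed_vector itself \<Rightarrow> bool" where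
  "frechet_smooth _ \<longleftrightarrow> (\<forall>x::'a. x \<noteq> 0 \<longrightarrow> (norm :: 'a \<Rightarrow> real) differentiable (at x))"

end

theory Submission
  imports Defs
begin

text \<open>
  Both conditions say that every norm-one functional \<open>f\<close> on \<open>X\<close> strongly exposes the unit ball: the
  slices \<open>{x. norm x \<le> 1 \<and> f x > 1 - \<eta>}\<close> shrink in diameter to \<open>0\<close>. For Frechet
  differentiability of the dual norm at \<open>f\<close> this is Smulian's criterion. Property 1 applied to the
  rank-one operator \<open>x \<mapsto> f x *\<^sub>R y\<close> says that near-maximisers of \<open>\<bar>f\<bar>\<close> are close to maximisers,
  and strict convexity makes the maximiser of \<open>f\<close> unique, so slices are small. Conversely, if
  \<open>norm (T (x n))\<close> tends to \<open>1\<close> for a compact \<open>T\<close>, then along a subsequence \<open>T (x n)\<close> tends to a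
  unit vector \<open>y\<close>; composing a functional that norms \<open>y\<close> with \<open>T\<close> gives a norm-one functional whose
  slices force the subsequence to converge to a point where \<open>T\<close> attains its norm.
\<close>

section \<open>Norming functionals\<close>

definition sublinear :: "('a::real_vector \<Rightarrow> real) \<Rightarrow> bool" where
  "sublinear p \<longleftrightarrow> (\<forall>x y. p (x + y) \<le> p x + p y) \<and> (\<forall>c\<ge>0. \<forall>x. p (c *\<^sub>R x) = c * p x)"

lemma sublinear_add: "sublinear p \<Longrightarrow> p (x + y) \<le> p x + p y"
  and sublinear_scale: "sublinear p \<Longrightarrow> c \<ge> 0 \<Longrightarrow> p (c *\<^sub>R x) = c * p x"
  by (auto simp: sublinear_def)

text \<open>One inequality suffices for homogeneity: taken with \<open>inverse c\<close> at
  \<open>c *\<^sub>R x\<close>, it gives the reverse one.\<close>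

lemma sublinearI:
  assumes "\<And>x y. p (x + y) \<le> p x + p y" and "p 0 = 0"
    and le: "\<And>c x. c > 0 \<Longrightarrow> p (c *\<^sub>R x) \<le> c * p x"
  shows "sublinear p"
  unfolding sublinear_def
proof (intro conjI allI impI assms(1))
  fix c :: real and x
  assume "c \<ge> 0"
  show "p (c *\<^sub>R x) = c * p x"
  proof (cases "c = 0")
    case True
    then show ?thesis using assms(2) by simp
  next
    case False
    with \<open>c \<ge> 0\<close> have c: "c > 0" by simp
    have "p x \<le> inverse c * p (c *\<^sub>R x)"
      using le[of "inverse c" "c *\<^sub>R x"] c by simp
    then have "c * p x \<le> p (c *\<^sub>R x)"
      using c by (simp add: field_simps)
    then show ?thesis using le[OF c, of x] by simp
  qed
qed

lemma sublinear_zero: "sublinear p \<Longrightarrow> p 0 = 0"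
  using sublinear_scale[of p 0 0] by simp

lemma sublinear_minus: "sublinear p \<Longrightarrow> - p (- x) \<le> p x"
  using sublinear_add[of p x "- x"] sublinear_zero[of p] by simp

lemma sublinear_norm: "sublinear norm"
  by (auto simp: sublinear_def norm_triangle_ineq)

text \<open>
  The witness is \<open>q x = inf {p (x + t *\<^sub>R y) - t * p y | t \<ge> 0}\<close>. It shows that a minimal sublinear
  functional is odd, hence linear, so that Zorn's lemma gives Hahn-Banach. Applied to the norm
  itself, it makes every linear functional below \<open>q\<close> norm \<open>y\<close>.
\<close>

lemma sublinear_decrease:
  fixes p :: "'a::real_vector \<Rightarrow> real"
  assumes p: "sublinear p"
  obtains q where "sublinear q" "q \<le> p" "q (- y) \<le> - p y"
proof -
  define A where "A x t = p (x + t *\<^sub>R y) - t * p y" for x t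
  define q where "q x = (INF t\<in>{0..}. A x t)" for x
  have bdd: "bdd_below (A x ` {0..})" for x
  proof (rule bdd_belowI2)
    fix t :: real
    assume "t \<in> {0..}"
    then show "- p (- x) \<le> A x t"
      using sublinear_add[OF p, of "x + t *\<^sub>R y" "- x"] sublinear_scale[OF p, of t y]
      by (simp add: A_def)
  qed
  have lower: "q x \<le> A x t" if "t \<ge> 0" for x t
    unfolding q_def using that by (intro cINF_lower bdd) simp
  have greatest: "m \<le> q x" if "\<And>t. t \<ge> 0 \<Longrightarrow> m \<le> A x t" for m x
    unfolding q_def using that by (intro cINF_greatest) auto
  have "sublinear q"
  proof (rule sublinearI)
    fix a b
    have "q (a + b) \<le> A a s + A b t" if "s \<ge> 0" "t \<ge> 0" for s t
    proof -
      have "q (a + b) \<le> A (a + b) (s + t)"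
        using that by (intro lower) simp
      also have "\<dots> \<le> A a s + A b t"
        using sublinear_add[OF p, of "a + s *\<^sub>R y" "b + t *\<^sub>R y"]
        by (simp add: A_def algebra_simps)
      finally show ?thesis .
    qed
    then have "q (a + b) - A a s \<le> q b" if "s \<ge> 0" for s
      using that by (intro greatest) (simp add: algebra_simps)
    then have "q (a + b) - q b \<le> q a"
      by (intro greatest) (simp add: algebra_simps)
    then show "q (a + b) \<le> q a + q b" by simp
  next
    have "A 0 t = 0" if "t \<ge> 0" for t
      using that by (simp add: A_def sublinear_scale[OF p])
    then show "q 0 = 0"
      using lower[of 0 0] greatest[of 0 0] by fastforce
  next
    fix c :: real and x
    assume c: "c > 0"
    have "q (c *\<^sub>R x) \<le> c * A x t" if "t \<ge> 0" for t
    proof -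
      have "q (c *\<^sub>R x) \<le> A (c *\<^sub>R x) (c * t)"
        using c that by (intro lower) simp
      also have "\<dots> = c * A x t"
        using sublinear_scale[OF p, of c "x + t *\<^sub>R y"] c by (simp add: A_def algebra_simps)
      finally show ?thesis .
    qed
    then have "q (c *\<^sub>R x) / c \<le> q x"
      using c by (intro greatest) (simp add: field_simps)
    then show "q (c *\<^sub>R x) \<le> c * q x"
      using c by (simp add: field_simps)
  qed
  moreover have "q \<le> p"
    using lower[of 0] by (simp add: le_fun_def A_def)
  \<comment> \<open>The parameter \<open>t = 1\<close> cancels \<open>- y\<close> and leaves
    \<open>p 0 - p y\<close>.\<close>
  moreover have "q (- y) \<le> - p y"
    using lower[of 1 "- y"] by (simp add: A_def sublinear_zero[OF p])
  ultimately show thesis by (rule that)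
qed

text \<open>Supplies the chain bound for Zorn's lemma. The pointwise infimum is finite since
  \<open>- p (- x) \<le> - q (- x) \<le> q x\<close>. Its subadditivity uses the chain: two members
  \<open>q\<close> and \<open>r\<close> are both bounded below by the smaller of them, which is
  subadditive.\<close>

lemma sublinear_INF_chain:
  fixes p :: "'a::real_vector \<Rightarrow> real"
  assumes "C \<noteq> {}" and C: "\<And>q. q \<in> C \<Longrightarrow> sublinear q \<and> q \<le> p"
    and chain: "\<And>q r. q \<in> C \<Longrightarrow> r \<in> C \<Longrightarrow> q \<le> r \<or> r \<le> q"
  obtains u where "sublinear u" "\<And>q. q \<in> C \<Longrightarrow> u \<le> q"
proof -
  define u where "u x = (INF q\<in>C. q x)" for x
  have bdd: "bdd_below ((\<lambda>q. q x) ` C)" for x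
  proof (rule bdd_belowI2)
    fix q
    assume "q \<in> C"
    with C have "sublinear q" "q \<le> p" by auto
    then show "- p (- x) \<le> q x"
      using sublinear_minus[of q x] le_funD[of q p "- x"] by linarith
  qed
  have lower: "u x \<le> q x" if "q \<in> C" for x q
    unfolding u_def using that by (intro cINF_lower[OF bdd])
  have greatest: "m \<le> u x" if "\<And>q. q \<in> C \<Longrightarrow> m \<le> q x" for m x
    unfolding u_def using that \<open>C \<noteq> {}\<close> by (intro cINF_greatest) auto
  have "sublinear u"
  proof (rule sublinearI)
    fix a b
    have le: "u (a + b) \<le> q a + r b" if qr: "q \<in> C" "r \<in> C" for q r
    proof -
      obtain s where s: "s \<in> C" "s \<le> q" "s \<le> r"
        using chain[OF qr] qr by blast
      have "u (a + b) \<le> s (a + b)" using s(1) by (rule lower)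
      also have "\<dots> \<le> s a + s b" using C[OF s(1)] by (simp add: sublinear_add)
      also have "\<dots> \<le> q a + r b" using s(2,3) by (intro add_mono) (auto simp: le_fun_def)
      finally show ?thesis .
    qed
    have "u (a + b) - q a \<le> u b" if "q \<in> C" for q
    proof (rule greatest)
      fix r
      assume "r \<in> C"
      then show "u (a + b) - q a \<le> r b" using le[OF that, of r] by simp
    qed
    then have "u (a + b) - u b \<le> u a"
      by (intro greatest) (simp add: algebra_simps)
    then show "u (a + b) \<le> u a + u b" by simp
  next
    have "q 0 = 0" if "q \<in> C" for q
      using C[OF that] by (simp add: sublinear_zero)
    moreover obtain q where "q \<in> C" using \<open>C \<noteq> {}\<close> by blast
    ultimately show "u 0 = 0"
      using lower[of q 0] greatest[of 0 0] by force
  next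
    fix c :: real and x
    assume c: "c > 0"
    have "u (c *\<^sub>R x) \<le> c * q x" if "q \<in> C" for q
      using lower[OF that, of "c *\<^sub>R x"] C[OF that] c by (simp add: sublinear_scale)
    then have "u (c *\<^sub>R x) / c \<le> u x"
      using c by (intro greatest) (simp add: field_simps)
    then show "u (c *\<^sub>R x) \<le> c * u x"
      using c by (simp add: field_simps)
  qed
  then show thesis
    using lower by (intro that) (auto simp: le_fun_def)
qed

text \<open>Lowering \<open>m\<close> by \<open>sublinear_decrease\<close> cannot change it, so
  \<open>m (- y) \<le> - m y\<close> and \<open>m\<close> is odd. Oddness turns subadditivity at
  \<open>- x\<close>, \<open>- y\<close> into superadditivity at \<open>x\<close>,
  \<open>y\<close>.\<close>

lemma linear_of_minimal_sublinear:
  fixes m :: "'a::real_vector \<Rightarrow> real"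
  assumes m: "sublinear m" and min: "\<And>q. sublinear q \<Longrightarrow> q \<le> m \<Longrightarrow> q = m"
  shows "linear m"
proof -
  have odd: "m (- y) = - m y" for y
  proof -
    obtain q where "sublinear q" "q \<le> m" "q (- y) \<le> - m y"
      using sublinear_decrease[OF m] by blast
    then have "m (- y) \<le> - m y" using min by blast
    then show ?thesis using sublinear_minus[OF m, of y] by simp
  qed
  show ?thesis
  proof (rule linearI)
    fix x y
    show "m (x + y) = m x + m y"
      using sublinear_add[OF m, of x y] sublinear_add[OF m, of "- x" "- y"]
        odd[of x] odd[of y] odd[of "x + y"] by simp
  next
    fix c :: real and x
    show "m (c *\<^sub>R x) = c *\<^sub>R m x"
    proof (cases "c \<ge> 0")
      case True
      then show ?thesis by (simp add: sublinear_scale[OF m])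
    next
      case False
      then show ?thesis
        using sublinear_scale[OF m, of "- c" x] odd[of "c *\<^sub>R x"] by simp
    qed
  qed
qed

theorem sublinear_dominates_linear:
  fixes p :: "'a::real_vector \<Rightarrow> real"
  assumes p: "sublinear p"
  obtains f where "linear f" "f \<le> p"
proof -
  define A where "A = {q. sublinear q \<and> q \<le> p}"
  \<comment> \<open>The order is reversed, so the maximal element from Zorn's lemma is a minimal
    sublinear functional.\<close>
  define P where "P q r \<longleftrightarrow> r \<le> q" for q r :: "'a \<Rightarrow> real"
  have "\<exists>m\<in>A. \<forall>q\<in>A. P m q \<longrightarrow> q = m"
  proof (rule predicate_Zorn)
    show "partial_order_on A (relation_of P A)"
      by (rule partial_order_on_relation_ofI) (auto simp: P_def)
  next
    fix C
    assume C: "C \<in> Chains (relation_of P A)"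
    show "\<exists>u\<in>A. \<forall>q\<in>C. P q u"
    proof (cases "C = {}")
      case True
      then show ?thesis using p by (auto simp: A_def)
    next
      case False
      have CA: "C \<subseteq> A" using C by (rule Chains_relation_of)
      have chain: "q \<le> r \<or> r \<le> q" if "q \<in> C" "r \<in> C" for q r
        using C that by (auto simp: Chains_def relation_of_def P_def)
      obtain u where u: "sublinear u" "\<And>q. q \<in> C \<Longrightarrow> u \<le> q"
        using sublinear_INF_chain[OF False _ chain, of p] CA by (auto simp: A_def)
      obtain q where "q \<in> C" using False by blast
      then have "u \<le> p" using u(2)[of q] CA by (auto simp: A_def)
      then show ?thesis using u by (auto simp: A_def P_def)
    qed
  qed
  then obtain m where m: "sublinear m" "m \<le> p"
    and min: "\<And>q. sublinear q \<Longrightarrow> q \<le> p \<Longrightarrow> q \<le> m \<Longrightarrow> q = m"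
    by (auto simp: A_def P_def)
  have "linear m"
    using m(1) min[OF _ order_trans[OF _ m(2)]] by (intro linear_of_minimal_sublinear) auto
  with m(2) show thesis by (intro that)
qed

text \<open>No functional is extended from the line through \<open>x\<close>. The norm is first
  lowered to \<open>p\<close> with \<open>p (- x) \<le> - norm x\<close>; any linear
  \<open>f\<close> below \<open>p\<close> is then bounded by the norm and at least
  \<open>norm x\<close> at \<open>x\<close>.\<close>

theorem norming_functional:
  fixes x :: "'a::real_normed_vector"
  obtains f :: "'a \<Rightarrow>\<^sub>L real" where "norm f \<le> 1" "f x = norm x"
proof -
  obtain p :: "'a \<Rightarrow> real" where p: "sublinear p" "p \<le> norm" "p (- x) \<le> - norm x"
    using sublinear_decrease[OF sublinear_norm] by blast
  obtain f where f: "linear f" "f \<le> p"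
    using sublinear_dominates_linear[OF p(1)] .
  have le: "f z \<le> norm z" for z
    using order_trans[OF f(2) p(2)] by (simp add: le_fun_def)
  have abs: "\<bar>f z\<bar> \<le> norm z" for z
    using le[of z] le[of "- z"] linear_neg[OF f(1), of z] by simp
  have bl: "bounded_linear f"
    using f(1) abs by (intro linear_conv_bounded_linear[THEN iffD1] bounded_linear_intro[where K = 1])
      (auto simp: linear_add linear_scale)
  have "f (- x) \<le> - norm x"
    using f(2) p(3) by (auto simp: le_fun_def intro: order_trans)
  then have "f x = norm x"
    using le[of x] linear_neg[OF f(1), of x] by simp
  then show thesis
    using abs by (intro that[of "Blinfun f"])
      (auto simp: bounded_linear_Blinfun_apply[OF bl] intro!: norm_blinfun_bound)
qed

lemma norming_functional_norm_1:
  fixes x :: "'a::real_normed_vector"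
  assumes "x \<noteq> 0"
  obtains f :: "'a \<Rightarrow>\<^sub>L real" where "norm f = 1" "f x = norm x"
proof -
  obtain f :: "'a \<Rightarrow>\<^sub>L real" where f: "norm f \<le> 1" "f x = norm x"
    by (rule norming_functional)
  have "norm x \<le> norm f * norm x"
    using norm_blinfun[of f x] f(2) by simp
  then have "norm f = 1" using f(1) assms by simp
  then show thesis using f(2) by (rule that)
qed

section \<open>Smulian's criterion\<close>

lemma blinfun_real_le_norm:
  fixes f :: "'a::real_normed_vector \<Rightarrow>\<^sub>L real"
  assumes "norm x \<le> 1"
  shows "f x \<le> norm f"
proof -
  have "f x \<le> norm f * norm x" using norm_blinfun[of f x] by simp
  also have "\<dots> \<le> norm f" using assms by (simp add: mult_left_le)
  finally show ?thesis .
qed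

text \<open>Since \<open>c\<close> is not an operator bound for \<open>f\<close>, some
  \<open>z\<close> violates it; normalising \<open>z\<close> and correcting its sign gives
  \<open>x\<close>.\<close>

lemma blinfun_real_almost_norming:
  fixes f :: "'a::real_normed_vector \<Rightarrow>\<^sub>L real"
  assumes "0 \<le> c" "c < norm f"
  obtains x where "norm x = 1" "f x > c"
proof -
  have "\<not> (\<forall>x. norm (f x) \<le> c * norm x)"
    using norm_blinfun_bound[of c f] assms by force
  then obtain z where z: "\<bar>f z\<bar> > c * norm z" by (auto simp: not_le)
  then have "z \<noteq> 0" by auto
  define x where "x = (sgn (f z) / norm z) *\<^sub>R z"
  have "f z \<noteq> 0" using z \<open>0 \<le> c\<close> by (metis abs_zero mult_nonneg_nonneg norm_ge_zero not_le)
  then have "norm x = 1" using \<open>z \<noteq> 0\<close> by (simp add: x_def abs_sgn_eq)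
  moreover have "f x = \<bar>f z\<bar> / norm z"
    by (simp add: x_def blinfun.scaleR_right abs_sgn mult.commute)
  then have "f x > c" using z \<open>z \<noteq> 0\<close> by (simp add: pos_less_divide_eq)
  ultimately show thesis by (rule that)
qed

text \<open>The level 1 is meant for \<open>norm f = 1\<close>. The exposed point is not named, so
  the condition can be stated and used as a Cauchy estimate before any maximiser of \<open>f\<close>
  is known.\<close>

definition strongly_exposes :: "('a::real_normed_vector \<Rightarrow>\<^sub>L real) \<Rightarrow> bool" where
  "strongly_exposes f \<longleftrightarrow>
     (\<forall>e>0. \<exists>\<eta>>0. \<forall>x y. norm x \<le> 1 \<longrightarrow> norm y \<le> 1 \<longrightarrow> f x > 1 - \<eta> \<longrightarrow> f y > 1 - \<eta> \<longrightarrow> norm (x - y) < e)"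

text \<open>Differentiability bounds \<open>norm (f + g) + norm (f - g)\<close> by 2 plus a small
  multiple of \<open>norm g\<close>. Evaluating \<open>f + g\<close> at \<open>x\<close> and
  \<open>f - g\<close> at \<open>y\<close>, with \<open>g\<close> a multiple of a functional norming
  \<open>x - y\<close>, turns this into a bound on \<open>norm (x - y)\<close>.\<close>

lemma strongly_exposes_if_norm_differentiable:
  fixes f :: "'a::real_normed_vector \<Rightarrow>\<^sub>L real"
  assumes f: "norm f = 1" and diff: "norm differentiable (at f)"
  shows "strongly_exposes f"
  unfolding strongly_exposes_def
proof (intro allI impI)
  fix e :: real
  assume "e > 0"
  \<comment> \<open>The estimate below ends with \<open>4 * e'\<close>: half comes from
    differentiability, half from the depth \<open>e' * r\<close> of the slice at two points.\<close>
  define e' where "e' = e / 5"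
  have e': "e' > 0" using \<open>e > 0\<close> by (simp add: e'_def)
  obtain D where "(norm has_derivative D) (at f)"
    using diff by (auto simp: differentiable_def)
  then obtain d where D: "bounded_linear D" and "d > 0"
    and d: "\<And>g. norm (g - f) < d \<Longrightarrow> norm (norm g - norm f - D (g - f)) \<le> e' * norm (g - f)"
    unfolding has_derivative_at_alt using e' by meson
  define r where "r = d / 2"
  have r: "0 < r" "r < d" using \<open>d > 0\<close> by (auto simp: r_def)
  \<comment> \<open>The derivative terms \<open>D g\<close> and \<open>D (- g)\<close> cancel in the
    sum.\<close>
  have upper: "norm (f + g) + norm (f - g) \<le> 2 + 2 * e' * r" if "norm g = r" for g
    using d[of "f + g"] d[of "f - g"] that r f bounded_linear.linear[OF D]
    by (auto simp: linear_neg abs_le_iff)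
  show "\<exists>\<eta>>0. \<forall>x y. norm x \<le> 1 \<longrightarrow> norm y \<le> 1 \<longrightarrow> f x > 1 - \<eta> \<longrightarrow> f y > 1 - \<eta> \<longrightarrow> norm (x - y) < e"
  proof (intro exI[of _ "e' * r"] conjI allI impI)
    show "e' * r > 0" using e' r by simp
  next
    fix x y
    assume x: "norm x \<le> 1" "f x > 1 - e' * r" and y: "norm y \<le> 1" "f y > 1 - e' * r"
    show "norm (x - y) < e"
    proof (cases "x = y")
      case True
      then show ?thesis using \<open>e > 0\<close> by simp
    next
      case False
      then obtain h :: "'a \<Rightarrow>\<^sub>L real" where h: "norm h = 1" "h (x - y) = norm (x - y)"
        using norming_functional_norm_1[of "x - y"] by auto
      define g where "g = r *\<^sub>R h"
      have g: "norm g = r" "g (x - y) = r * norm (x - y)"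
        using h r by (auto simp: g_def blinfun.scaleR_left)
      have "(f + g) x + (f - g) y \<le> 2 + 2 * e' * r"
        using blinfun_real_le_norm[OF x(1), of "f + g"] blinfun_real_le_norm[OF y(1), of "f - g"]
          upper[OF g(1)] by linarith
      then have "r * norm (x - y) < r * (4 * e')"
        using x(2) y(2) g(2) by (simp add: blinfun.bilinear_simps algebra_simps)
      then have "norm (x - y) < 4 * e'" using r by simp
      then show ?thesis using \<open>e > 0\<close> by (simp add: e'_def)
    qed
  qed
qed

text \<open>With \<open>h = f + g\<close>, evaluation at \<open>z\<close> gives
  \<open>norm h \<ge> 1 + g z\<close>. For the upper bound, a point \<open>x\<close> that almost
  norms \<open>h\<close> lies in a thin slice of \<open>f\<close>, hence near \<open>z\<close>, so
  \<open>g x\<close> exceeds \<open>g z\<close> by only a small multiple of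
  \<open>norm g\<close>.\<close>

lemma norm_has_derivative_at_exposing:
  fixes f :: "'a::real_normed_vector \<Rightarrow>\<^sub>L real"
  assumes f: "norm f = 1" and z: "norm z \<le> 1" "f z = 1"
    and slice: "\<And>e. e > 0 \<Longrightarrow> \<exists>\<eta>>0. \<forall>x. norm x = 1 \<longrightarrow> f x > 1 - \<eta> \<longrightarrow> norm (x - z) < e"
  shows "(norm has_derivative (\<lambda>g. blinfun_apply g z)) (at f)"
  unfolding has_derivative_at_alt
proof (intro conjI allI impI)
  show "bounded_linear (\<lambda>g::'a \<Rightarrow>\<^sub>L real. g z)"
    by (rule blinfun.bounded_linear_left)
next
  fix e :: real
  assume "e > 0"
  then obtain \<eta> where "\<eta> > 0"
    and \<eta>: "\<And>x. norm x = 1 \<Longrightarrow> f x > 1 - \<eta> \<Longrightarrow> norm (x - z) < e / 2"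
    using slice[of "e / 2"] by auto
  \<comment> \<open>The second bound puts \<open>x\<close> into the slice of depth
    \<open>\<eta>\<close>; the first serves the degenerate case \<open>c < 0\<close>.\<close>
  define d where "d = min (1 / 2) (\<eta> / (2 + e))"
  have d: "d > 0" "d \<le> 1 / 2"
    using \<open>\<eta> > 0\<close> \<open>e > 0\<close> unfolding d_def by (simp, intro min.cobounded1)
  have "d \<le> \<eta> / (2 + e)" unfolding d_def by (rule min.cobounded2)
  then have "(2 + e) * d \<le> \<eta>"
    using \<open>e > 0\<close> by (simp add: pos_le_divide_eq mult.commute)
  show "\<exists>d>0. \<forall>h. norm (h - f) < d \<longrightarrow> norm (norm h - norm f - (h - f) z) \<le> e * norm (h - f)"
  proof (intro exI[of _ d] conjI allI impI)
    fix h
    assume h: "norm (h - f) < d"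
    define g where "g = h - f"
    have hg: "h = f + g" by (simp add: g_def)
    have g: "norm g < d" using h by (simp add: g_def)
    have low: "1 + g z \<le> norm h"
      using blinfun_real_le_norm[OF z(1), of h] z(2) by (simp add: hg blinfun.add_left)
    have "norm h \<le> 1 + g z + e * norm g"
    proof (cases "g = 0")
      case True
      then show ?thesis using f by (simp add: hg)
    next
      case False
      \<comment> \<open>Half of the allowed error \<open>e * norm g\<close> goes to almost norming
        \<open>h\<close>, the other half to \<open>g (x - z)\<close>.\<close>
      define c where "c = norm h - e / 2 * norm g"
      have nh: "norm h \<ge> 1 - norm g"
        using norm_triangle_ineq2[of f "- g"] f by (simp add: hg)
      show ?thesis
      proof (cases "c \<ge> 0")
        case True
        have "c < norm h" using False \<open>e > 0\<close> by (simp add: c_def)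
        then obtain x where x: "norm x = 1" "h x > c"
          using blinfun_real_almost_norming[OF True] by blast
        have "g x \<le> norm g" using x(1) by (intro blinfun_real_le_norm) simp
        then have "f x > 1 - (2 + e / 2) * norm g"
          using x(2) nh by (simp add: hg c_def blinfun.add_left algebra_simps)
        moreover have "(2 + e / 2) * norm g \<le> (2 + e) * d"
          using g \<open>e > 0\<close> by (intro mult_mono) auto
        ultimately have "norm (x - z) < e / 2"
          using \<eta>[OF x(1)] \<open>(2 + e) * d \<le> \<eta>\<close> by linarith
        then have "norm g * norm (x - z) \<le> norm g * (e / 2)"
          by (intro mult_left_mono) auto
        moreover have "g (x - z) \<le> norm g * norm (x - z)"
          using norm_blinfun[of g "x - z"] by simp
        ultimately have "g x \<le> g z + e / 2 * norm g"
          by (simp add: blinfun.diff_right mult.commute)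
        moreover have "f x \<le> 1" using blinfun_real_le_norm[of x f] x(1) f by simp
        ultimately show ?thesis
          using x(2) by (simp add: hg c_def blinfun.add_left)
      next
        case False
        \<comment> \<open>No almost norming point is needed here:
          \<open>norm h \<le> e * norm g\<close>, and
          \<open>1 + g z \<ge> 1 - norm g > 0\<close>.\<close>
        have "- g z \<le> norm g"
          using blinfun_real_le_norm[OF z(1), of "- g"] by (simp add: blinfun.minus_left)
        moreover have "e * norm g \<ge> 0" using \<open>e > 0\<close> by simp
        moreover have "2 * norm h \<le> e * norm g" using False by (simp add: c_def)
        ultimately show ?thesis
          using g d(2) by linarith
      qed
    qed
    then show "norm (norm h - norm f - (h - f) z) \<le> e * norm (h - f)"
      using low f \<open>e > 0\<close> by (simp add: g_def[symmetric] abs_le_iff)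
  qed (rule d(1))
qed

section \<open>Reduction of smoothness to the unit sphere\<close>

lemma norm_differentiable_scaleR:
  fixes x :: "'a::real_normed_vector"
  assumes "norm differentiable (at x)" and "c > 0"
  shows "norm differentiable (at (c *\<^sub>R x))"
proof -
  have eq: "norm = (\<lambda>z::'a. c * norm (z /\<^sub>R c))" using \<open>c > 0\<close> by auto
  have "(\<lambda>z::'a. norm (z /\<^sub>R c)) differentiable (at (c *\<^sub>R x))"
    using assms differentiable_chain_at[of "\<lambda>z::'a. z /\<^sub>R c" "c *\<^sub>R x" norm]
    by (simp add: o_def)
  then have "(\<lambda>z::'a. c * norm (z /\<^sub>R c)) differentiable (at (c *\<^sub>R x))"
    by simp
  then show ?thesis by (subst eq)
qed

lemma frechet_smooth_iff_unit_sphere: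
  "frechet_smooth TYPE('a::real_normed_vector)
     \<longleftrightarrow> (\<forall>x::'a. norm x = 1 \<longrightarrow> norm differentiable (at x))"
proof
  assume *: "\<forall>x::'a. norm x = 1 \<longrightarrow> norm differentiable (at x)"
  show "frechet_smooth TYPE('a)"
    unfolding frechet_smooth_def
  proof (intro allI impI)
    fix x :: 'a
    assume "x \<noteq> 0"
    then have "norm differentiable (at (norm x *\<^sub>R sgn x))"
      using * by (intro norm_differentiable_scaleR) (auto simp: norm_sgn)
    then show "norm differentiable (at x)"
      using \<open>x \<noteq> 0\<close> by (simp add: sgn_div_norm)
  qed
qed (metis frechet_smooth_def norm_zero zero_neq_one)

section \<open>The equivalence\<close>

text \<open>If \<open>norm (x + y)\<close> were 2, a functional norming \<open>x + y\<close> would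
  be 1 at both points, so both would lie in all its slices and coincide.\<close>

lemma strictly_convex_space_if_strongly_exposes:
  assumes exp: "\<And>f::'a::real_normed_vector \<Rightarrow>\<^sub>L real. norm f = 1 \<Longrightarrow> strongly_exposes f"
  shows "strictly_convex_space TYPE('a)"
  unfolding strictly_convex_space_def
proof (intro ballI impI)
  fix x y :: 'a
  assume "x \<in> sphere 0 1" "y \<in> sphere 0 1" and "x \<noteq> y"
  then have x: "norm x = 1" and y: "norm y = 1" by auto
  show "norm (x + y) < 2"
  proof (rule ccontr)
    assume *: "\<not> norm (x + y) < 2"
    then have "x + y \<noteq> 0" by auto
    then obtain f :: "'a \<Rightarrow>\<^sub>L real" where f: "norm f = 1" "f (x + y) = norm (x + y)"
      using norming_functional_norm_1[of "x + y"] by auto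
    have "f x = 1" "f y = 1"
      using blinfun_real_le_norm[of x f] blinfun_real_le_norm[of y f] f * x y
      by (auto simp: blinfun.add_right)
    then have "norm (x - y) < e" if "e > 0" for e
      using exp[OF f(1)] x y that unfolding strongly_exposes_def by fastforce
    from this[of "norm (x - y)"] \<open>x \<noteq> y\<close> show False by simp
  qed
qed

lemma property_1_compact_if_strongly_exposes:
  assumes exp: "\<And>f::'a::banach \<Rightarrow>\<^sub>L real. norm f = 1 \<Longrightarrow> strongly_exposes f"
  shows "property_1_compact TYPE('a) TYPE('b::real_normed_vector)"
  unfolding property_1_compact_def
proof (intro ballI allI impI, rule ccontr)
  fix T :: "'a \<Rightarrow>\<^sub>L 'b" and \<epsilon> :: real
  assume "T \<in> sphere 0 1" and "compact_operator T" and "\<epsilon> > 0"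
  then have T: "norm T = 1" and cpt: "compact (closure (T ` cball 0 1))"
    by (auto simp: compact_operator_def)
  assume "\<not> (\<exists>\<eta>>0. \<forall>x0\<in>sphere 0 1. norm (T x0) > 1 - \<eta> \<longrightarrow>
           (\<exists>x1\<in>sphere 0 1. norm (T x1) = 1 \<and> norm (x1 - x0) < \<epsilon>))"
  \<comment> \<open>Failure at every \<open>\<eta> = 1 / real (Suc n)\<close> gives almost
    maximisers that stay \<open>\<epsilon>\<close> away from all maximisers of
    \<open>norm (T x)\<close>.\<close>
  then have "\<forall>n. \<exists>x. norm x = 1 \<and> norm (T x) > 1 - 1 / real (Suc n) \<and>
      (\<forall>x1. norm x1 = 1 \<longrightarrow> norm (T x1) = 1 \<longrightarrow> norm (x1 - x) \<ge> \<epsilon>)"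
    by (force simp: not_less)
  then obtain x where x: "\<And>n. norm (x n) = 1" and Tx: "\<And>n. norm (T (x n)) > 1 - 1 / real (Suc n)"
    and far: "\<And>n x1. norm x1 = 1 \<Longrightarrow> norm (T x1) = 1 \<Longrightarrow> norm (x1 - x n) \<ge> \<epsilon>"
    by metis
  have "\<forall>n. T (x n) \<in> closure (T ` cball 0 1)"
    using x by (intro allI closure_subset[THEN subsetD]) auto
  then obtain y k where k: "strict_mono k" and y: "(\<lambda>n. T (x (k n))) \<longlonglongrightarrow> y"
    by (rule seq_compactE[OF cpt[unfolded compact_eq_seq_compact_metric], unfolded o_def])
  have le1: "norm (T (x n)) \<le> 1" for n
    using norm_blinfun[of T "x n"] T x[of n] by simp
  have "(\<lambda>n. norm (T (x n))) \<longlonglongrightarrow> 1"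
  proof (rule tendsto_sandwich)
    show "(\<lambda>n. 1 - 1 / real (Suc n)) \<longlonglongrightarrow> 1"
      using tendsto_diff[OF tendsto_const[of 1] LIMSEQ_inverse_real_of_nat] by (simp add: field_simps)
  qed (use Tx le1 in \<open>auto simp: less_imp_le\<close>)
  from LIMSEQ_subseq_LIMSEQ[OF this k] have "(\<lambda>n. norm (T (x (k n)))) \<longlonglongrightarrow> 1"
    by (simp add: o_def)
  then have ny: "norm y = 1"
    using LIMSEQ_unique[OF tendsto_norm[OF y]] by simp
  then have "y \<noteq> 0" by auto
  then obtain h :: "'b \<Rightarrow>\<^sub>L real" where h: "norm h = 1" "h y = 1"
    using norming_functional_norm_1[of y] ny by auto
  \<comment> \<open>Pulling \<open>h\<close> back along \<open>T\<close> makes the subsequence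
    maximising for a norm-one functional on \<open>'a\<close>.\<close>
  define f where "f = h o\<^sub>L T"
  have fx: "(\<lambda>n. f (x (k n))) \<longlonglongrightarrow> 1"
    using blinfun.tendsto[OF tendsto_const y, of h] h(2) by (simp add: f_def)
  have "norm f \<le> 1"
    using norm_blinfun_compose[of h T] h T by (simp add: f_def)
  moreover have "1 \<le> norm f"
    using x by (intro LIMSEQ_le_const2[OF fx] exI allI impI blinfun_real_le_norm) simp
  ultimately have "strongly_exposes f" by (intro exp) simp
  \<comment> \<open>Each slice of \<open>f\<close> contains a tail of the subsequence; completeness
    of \<open>'a\<close> then yields the limit \<open>z\<close>, a maximiser that contradicts
    \<open>far\<close>.\<close>
  have "Cauchy (\<lambda>n. x (k n))"
    unfolding Cauchy_iff
  proof (intro allI impI)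
    fix e :: real
    assume "e > 0"
    then obtain \<eta> where "\<eta> > 0" and \<eta>: "\<And>u v. norm u \<le> 1 \<Longrightarrow> norm v \<le> 1 \<Longrightarrow>
        f u > 1 - \<eta> \<Longrightarrow> f v > 1 - \<eta> \<Longrightarrow> norm (u - v) < e"
      using \<open>strongly_exposes f\<close> unfolding strongly_exposes_def by meson
    have "eventually (\<lambda>n. f (x (k n)) > 1 - \<eta>) sequentially"
      using \<open>\<eta> > 0\<close> by (intro order_tendstoD(1)[OF fx]) simp
    then show "\<exists>M. \<forall>m\<ge>M. \<forall>n\<ge>M. norm (x (k m) - x (k n)) < e"
      unfolding eventually_sequentially using \<eta>[OF eq_refl eq_refl, OF x x] by blast
  qed
  then obtain z where z: "(\<lambda>n. x (k n)) \<longlonglongrightarrow> z"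
    by (auto simp: Cauchy_convergent_iff convergent_def)
  have "norm z = 1"
    using LIMSEQ_unique[OF tendsto_norm[OF z]] x by simp
  moreover have "T z = y"
    using LIMSEQ_unique[OF blinfun.tendsto[OF tendsto_const z] y] .
  ultimately have "norm (z - x (k n)) \<ge> \<epsilon>" for n
    using ny by (intro far) auto
  moreover have "(\<lambda>n. norm (z - x (k n))) \<longlonglongrightarrow> 0"
    using tendsto_norm[OF tendsto_diff[OF tendsto_const z, of z]] by simp
  ultimately have "\<epsilon> \<le> 0" by (intro LIMSEQ_le_const) auto
  with \<open>\<epsilon> > 0\<close> show False by simp
qed

section \<open>From strict convexity and Property 1 to smoothness\<close>

text \<open>These are the test operators for Property 1. They are compact because the unit ball is
  mapped into a compact segment of multiples of \<open>y\<close>.\<close>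

lemma rank_one_compact_operator:
  fixes f :: "'a::real_normed_vector \<Rightarrow>\<^sub>L real" and y :: "'b::real_normed_vector"
  obtains T :: "'a \<Rightarrow>\<^sub>L 'b" where "\<And>x. T x = f x *\<^sub>R y" "norm T = norm f * norm y" "compact_operator T"
proof -
  define T where "T = blinfun_scaleR_left y o\<^sub>L f"
  have T: "T x = f x *\<^sub>R y" for x by (simp add: T_def)
  have "norm T = norm f * norm y"
  proof (rule antisym)
    show "norm T \<le> norm f * norm y"
    proof (rule norm_blinfun_bound)
      fix x
      show "norm (T x) \<le> norm f * norm y * norm x"
        using mult_right_mono[OF norm_blinfun[of f x], of "norm y"] by (simp add: T mult_ac)
    qed simp
    show "norm f * norm y \<le> norm T"
    proof (cases "y = 0")
      case False
      have "norm f \<le> norm T / norm y"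
      proof (rule norm_blinfun_bound)
        fix x
        show "norm (f x) \<le> norm T / norm y * norm x"
          using norm_blinfun[of T x] False by (simp add: T field_simps)
      qed simp
      then show ?thesis using False by (simp add: field_simps)
    qed simp
  qed
  moreover have "compact_operator T"
    unfolding compact_operator_def
  proof -
    let ?K = "(\<lambda>t. t *\<^sub>R y) ` cball 0 (norm f)"
    have K: "compact ?K"
      by (intro compact_continuous_image continuous_intros compact_cball)
    have "T ` cball 0 1 \<subseteq> ?K"
    proof
      fix v
      assume "v \<in> T ` cball 0 1"
      then obtain x where "norm x \<le> 1" "v = f x *\<^sub>R y" by (auto simp: T)
      moreover from this(1) have "norm (f x) \<le> norm f"
        using norm_blinfun[of f x] mult_left_le[of "norm x" "norm f"] by simp
      ultimately show "v \<in> ?K" by auto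
    qed
    then have "closure (T ` cball 0 1) \<subseteq> ?K"
      using K by (intro closure_minimal compact_imp_closed)
    then show "compact (closure (T ` cball 0 1))"
      using K closed_closure by (metis compact_Int_closed inf.absorb_iff2)
  qed
  ultimately show thesis using T by (intro that)
qed

lemma norm_differentiable_if_property_1:
  fixes f :: "'a::real_normed_vector \<Rightarrow>\<^sub>L real"
  assumes sc: "strictly_convex_space TYPE('a)"
    and p1: "property_1_compact TYPE('a) TYPE('b::real_normed_vector)"
    and ne: "(UNIV :: 'b set) \<noteq> {0}" and f: "norm f = 1"
  shows "norm differentiable (at f)"
proof -
  obtain v :: 'b where "v \<noteq> 0" using ne by auto
  obtain T :: "'a \<Rightarrow>\<^sub>L 'b" where T: "\<And>x. T x = f x *\<^sub>R sgn v" "norm T = 1" "compact_operator T"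
    using rank_one_compact_operator[of f "sgn v"] f \<open>v \<noteq> 0\<close> by (auto simp: norm_sgn)
  have nT: "norm (T x) = \<bar>f x\<bar>" for x
    using \<open>v \<noteq> 0\<close> by (simp add: T(1) norm_sgn)
  have near: "\<exists>\<eta>>0. \<forall>x. norm x = 1 \<longrightarrow> f x > 1 - \<eta> \<longrightarrow>
      (\<exists>z. norm z = 1 \<and> f z = 1 \<and> norm (x - z) < e)" if "e > 0" for e
  proof -
    \<comment> \<open>Property 1 only yields \<open>\<bar>f z\<bar> = 1\<close>. With
      \<open>f x > 0\<close> and \<open>z\<close> at distance less than 1 from \<open>x\<close>, the
      value \<open>f z = -1\<close> is excluded.\<close>
    have "min e 1 > 0" using that by simp
    moreover have "T \<in> sphere 0 1" using T(2) by simp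
    ultimately have "\<exists>\<eta>>0. \<forall>x\<in>sphere 0 1. norm (T x) > 1 - \<eta> \<longrightarrow>
        (\<exists>z\<in>sphere 0 1. norm (T z) = 1 \<and> norm (z - x) < min e 1)"
      using p1 T(3) unfolding property_1_compact_def by blast
    then obtain \<eta> where "\<eta> > 0" and \<eta>: "\<And>x. norm x = 1 \<Longrightarrow> \<bar>f x\<bar> > 1 - \<eta> \<Longrightarrow>
        \<exists>z. norm z = 1 \<and> \<bar>f z\<bar> = 1 \<and> norm (z - x) < min e 1"
      unfolding nT Bex_def Ball_def mem_sphere_0 by blast
    show ?thesis
    proof (intro exI[of _ "min \<eta> 1"] conjI allI impI)
      fix x
      assume x: "norm x = 1" "f x > 1 - min \<eta> 1"
      then have "\<bar>f x\<bar> > 1 - \<eta>" by auto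
      then obtain z where z: "norm z = 1" "\<bar>f z\<bar> = 1" "norm (z - x) < min e 1"
        using \<eta>[OF x(1)] by blast
      have "\<bar>f (z - x)\<bar> < 1"
        using norm_blinfun[of f "z - x"] z(3) f by simp
      then have "f z = 1" using z(2) x(2) by (auto simp: blinfun.diff_right)
      then show "\<exists>z. norm z = 1 \<and> f z = 1 \<and> norm (x - z) < e"
        using z by (auto simp: norm_minus_commute)
    qed (use \<open>\<eta> > 0\<close> in simp)
  qed
  have unique: "z = w" if "norm z = 1" "f z = 1" "norm w = 1" "f w = 1" for z w
  proof (rule ccontr)
    assume "z \<noteq> w"
    then have "norm (z + w) < 2"
      using sc that by (simp add: strictly_convex_space_def)
    moreover have "2 \<le> norm (z + w)"
      using norm_blinfun[of f "z + w"] f that by (simp add: blinfun.add_right)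
    ultimately show False by simp
  qed
  obtain \<eta> where "\<eta> > 0" and \<eta>: "\<And>x. norm x = 1 \<Longrightarrow> f x > 1 - \<eta> \<Longrightarrow> \<exists>z. norm z = 1 \<and> f z = 1"
    using near[OF zero_less_one] by blast
  \<comment> \<open>An almost norming point has a maximiser of \<open>f\<close> near it, so
    \<open>f\<close> attains its norm. The \<open>max\<close> keeps the level nonnegative.\<close>
  obtain x where "norm x = 1" "f x > max 0 (1 - \<eta>)"
    using blinfun_real_almost_norming[of "max 0 (1 - \<eta>)" f] f \<open>\<eta> > 0\<close> by auto
  then obtain z where z: "norm z = 1" "f z = 1" using \<eta>[of x] by auto
  have "(norm has_derivative (\<lambda>g. blinfun_apply g z)) (at f)"
  proof (rule norm_has_derivative_at_exposing)
    fix e :: real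
    assume "e > 0"
    \<comment> \<open>The maximiser that \<open>near\<close> provides may depend on
      \<open>x\<close>, but by strict convexity it is always \<open>z\<close>.\<close>
    then show "\<exists>\<eta>>0. \<forall>x. norm x = 1 \<longrightarrow> f x > 1 - \<eta> \<longrightarrow> norm (x - z) < e"
      using near[of e] unique z by metis
  qed (use f z in auto)
  then show ?thesis by (auto simp: differentiable_def)
qed

theorem theorem2p3:
  assumes "(UNIV :: 'a::banach set) \<noteq> {0}"
    and "(UNIV :: 'b::banach set) \<noteq> {0}"
  shows "strictly_convex_space TYPE('a) \<and> property_1_compact TYPE('a) TYPE('b)
     \<longleftrightarrow> frechet_smooth TYPE('a \<Rightarrow>\<^sub>L real)"
proof
  assume "strictly_convex_space TYPE('a) \<and> property_1_compact TYPE('a) TYPE('b)"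
  then show "frechet_smooth TYPE('a \<Rightarrow>\<^sub>L real)"
    using norm_differentiable_if_property_1[OF _ _ assms(2)]
    by (auto simp: frechet_smooth_iff_unit_sphere)
next
  assume "frechet_smooth TYPE('a \<Rightarrow>\<^sub>L real)"
  then have "strongly_exposes f" if "norm f = 1" for f :: "'a \<Rightarrow>\<^sub>L real"
    using that by (simp add: frechet_smooth_iff_unit_sphere strongly_exposes_if_norm_differentiable)
  then show "strictly_convex_space TYPE('a) \<and> property_1_compact TYPE('a) TYPE('b)"
    by (simp add: strictly_convex_space_if_strongly_exposes property_1_compact_if_strongly_exposes)
qed

end
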